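(* Let $n\in\mathbb{N}$, $D=\{0,\dots,n-1\}$, $a\in D\setminus\{0\}$ and $b\in D\setminus\{n-1\}$. For the maximal $C$-clone $\mathrm{Pol}(R^{(a)}_{(b)})$ on $D$ there exists precisely one maximal clone $M$ on $D$ such that $\mathrm{Pol}(R^{(a)}_{(b)})\subseteq M$. More precisely: \begin{itemize} \item for $n=2$ one has $\mathrm{Pol}(R^{(1)}_{(0)})=\mathrm{Pol}(\leq_2)$, where $\leq_2$ is the canonical linear order on $\{0,1\}$; \item for $n\geq 3$ the following inclusions hold: \begin{itemize} \item if $a-b>1$, then $\mathrm{Pol}(R^{(a)}_{(b)})\subseteq\mathrm{Pol}(\rho)$, where $\rho=\{0,\dots,b\}\cup\{a,\dots,n-1\}$ is a unary non-trivial relation; \item if $a-b=1$, then $\mathrm{Pol}(R^{(a)}_{(b)})\subseteq\mathrm{Pol}(\theta)$, where $\theta$ is the equivalence relation on $D$ given by the partition $D/\theta=\{\{0,\dots,b\},\{a,\dots,n-1\}\}$; \item if $a-b<1$, then $\mathrm{Pol}(R^{(a)}_{(b)})\subseteq\mathrm{Pol}(\sigma_{a,b})$, where $\sigma_{a,b}$ denotes the binary central relation $\{0,\dots,b\}^2\cup\{a,\dots,n-1\}^2$. \end{itemize} \end{itemize}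
   Context: Let $D=\{0,1,\dots,n-1\}$ with its canonical linear order $\leq$. For $k\geq1$, $\mathrm{O}_D^{(k)}$ is the set of all functions $D^k\to D$, and $\mathrm{O}_D=\bigcup_{k\geq1}\mathrm{O}_D^{(k)}$. An operation $f\in\mathrm{O}_D^{(k)}$ preserves a relation $\varrho\subseteq D^m$ ($m\ge 1$) if for all $r_1,\dots,r_k\in\varrho$ the tuple obtained by applying $f$ componentwise to $r_1,\dots,r_k$ lies in $\varrho$. For a set $Q$ of finitary relations on $D$, $\mathrm{Pol}(Q)$ is the set of all $f\in\mathrm{O}_D$ preserving every member of $Q$; $\mathrm{Pol}(\rho)=\mathrm{Pol}(\{\rho\})$. A clone on $D$ is a set of finitary operations on $D$ that contains all projections and is closed under composition. A maximal clone is a co-atom of the lattice of all clones on $D$ ordered by inclusion (i.e. a clone $M\subsetneq\mathrm{O}_D$ such that no clone lies strictly between $M$ and $\mathrm{O}_D$). For $p,q\geq1$, $\mathbf a\in D^p$, $\mathbf b\in D^q$, the clausal relation $R^{\mathbf a}_{\mathbf b}$ is the set of all $(x_1,\dots,x_p,y_1,\dots,y_q)\in D^{p+q}$ satisfying $(x_1\geq a_1)\vee\dots\vee(x_p\geq a_p)\vee(y_1\leq b_1)\vee\dots\vee(y_q\leq b_q)$. In particular $R^{(a)}_{(b)}=\{(x,y)\in D^2: x\geq a\text{ or }y\leq b\}$. A $C$-clone is a set of the form $\mathrm{Pol}(Q)$ with $Q$ a set of clausal relations on $D$; a maximal $C$-clone is a co-atom of the lattice of all $C$-clones on $D$ ordered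 by inclusion. It is known that the maximal $C$-clones on $D$ are exactly the sets $\mathrm{Pol}(R^{(a)}_{(b)})$ with $a\in D\setminus\{0\}$ and $b\in D\setminus\{n-1\}$. A unary relation $\rho\subseteq D$ is non-trivial if $\emptyset\subsetneq\rho\subsetneq D$. A binary central relation is a reflexive symmetric relation $\rho\subseteq D^2$, different from $\Delta=\{(x,x):x\in D\}$ and $D^2$, having a central element, i.e. some $c\in D$ with $(c,x),(x,c)\in\rho$ for all $x\in D$. *)

theory Defs
  imports Main "HOL-Library.FuncSet"
begin

text \<open>Elements of \<open>D\<^sup>k\<close>, for \<open>D = {..<n}\<close>, are lists of length \<open>k\<close>.\<close>

definition tuples :: "nat \<Rightarrow> nat \<Rightarrow> nat list set" where
  "tuples n k = {xs. length xs = k \<and> set xs \<subseteq> {..<n}}"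

text \<open>
  An operation is a pair of its arity and a function that is \<^const>\<open>undefined\<close> outside
  \<open>D\<^sup>k\<close>. Extensionality makes HOL equality of such pairs coincide with equality of
  operations; the arity is recorded because the extensional function alone does not always
  determine it.
\<close>

type_synonym operation = "nat \<times> (nat list \<Rightarrow> nat)"

definition operations :: "nat \<Rightarrow> operation set" where
  "operations n = {(k, f). k \<ge> 1 \<and> f \<in> tuples n k \<rightarrow>\<^sub>E {..<n}}"

definition projection :: "nat \<Rightarrow> nat \<Rightarrow> nat \<Rightarrow> operation" where
  "projection n k i = (k, restrict (\<lambda>xs. xs ! i) (tuples n k))"

definition composition ::
  "nat \<Rightarrow> (nat list \<Rightarrow> nat) \<Rightarrow> nat \<Rightarrow> (nat list \<Rightarrow> nat) list \<Rightarrow> operation" where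
  "composition n f m gs = (m, restrict (\<lambda>xs. f (map (\<lambda>g. g xs) gs)) (tuples n m))"

definition clone :: "nat \<Rightarrow> operation set \<Rightarrow> bool" where
  "clone n C \<longleftrightarrow>
     C \<subseteq> operations n \<and>
     (\<forall>k i. i < k \<longrightarrow> projection n k i \<in> C) \<and>
     (\<forall>k f m gs. (k, f) \<in> C \<and> length gs = k \<and> (\<forall>g\<in>set gs. (m, g) \<in> C)
        \<longrightarrow> composition n f m gs \<in> C)"

definition maximal_clone :: "nat \<Rightarrow> operation set \<Rightarrow> bool" where
  "maximal_clone n M \<longleftrightarrow>
     clone n M \<and> M \<subset> operations n \<and> \<not> (\<exists>C. clone n C \<and> M \<subset> C \<and> C \<subset> operations n)"

text \<open>
  An \<open>m\<close>-ary relation on \<open>D\<close> is a subset of \<^term>\<open>tuples n m\<close>. In the next definition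
  \<open>rs\<close> lists the rows \<open>r\<^sub>1, \<dots>, r\<^sub>k\<close>; the quantified \<open>m\<close> is the arity of \<open>\<rho>\<close>
  whenever \<open>\<rho>\<close> is nonempty.
\<close>

definition preserves :: "nat \<Rightarrow> operation \<Rightarrow> nat list set \<Rightarrow> bool" where
  "preserves n = (\<lambda>(k, f) \<rho>.
     \<forall>m rs. length rs = k \<and> set rs \<subseteq> \<rho> \<inter> tuples n m
       \<longrightarrow> map (\<lambda>i. f (map (\<lambda>r. r ! i) rs)) [0..<m] \<in> \<rho>)"

definition Pol :: "nat \<Rightarrow> nat list set set \<Rightarrow> operation set" where
  "Pol n Q = {f \<in> operations n. \<forall>\<rho>\<in>Q. preserves n f \<rho>}"

definition clausal_rel :: "nat \<Rightarrow> nat list \<Rightarrow> nat list \<Rightarrow> nat list set" where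
  "clausal_rel n a b =
     {x @ y | x y. x \<in> tuples n (length a) \<and> y \<in> tuples n (length b) \<and>
        ((\<exists>i<length a. x ! i \<ge> a ! i) \<or> (\<exists>j<length b. y ! j \<le> b ! j))}"

text \<open>Encodings of unary and binary relations given as subsets of \<open>D\<close> and \<open>D \<times> D\<close>.\<close>

definition unary_rel :: "nat set \<Rightarrow> nat list set" where
  "unary_rel A = {[x] | x. x \<in> A}"

definition binary_rel :: "(nat \<times> nat) set \<Rightarrow> nat list set" where
  "binary_rel r = {[x, y] | x y. (x, y) \<in> r}"

definition leq_rel :: "nat \<Rightarrow> (nat \<times> nat) set" where
  "leq_rel n = {(x, y). x < n \<and> y < n \<and> x \<le> y}"

definition nontrivial_unary :: "nat \<Rightarrow> nat set \<Rightarrow> bool" where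
  "nontrivial_unary n A \<longleftrightarrow> {} \<subset> A \<and> A \<subset> {..<n}"

definition binary_central :: "nat \<Rightarrow> (nat \<times> nat) set \<Rightarrow> bool" where
  "binary_central n r \<longleftrightarrow>
     r \<subseteq> {..<n} \<times> {..<n} \<and> refl_on {..<n} r \<and> sym r \<and>
     r \<noteq> Id_on {..<n} \<and> r \<noteq> {..<n} \<times> {..<n} \<and>
     (\<exists>c<n. \<forall>x<n. (c, x) \<in> r \<and> (x, c) \<in> r)"

end

theory Submission imports Defs begin

text \<open>
  Let \<open>R = {(x, y). a \<le> x \<or> y \<le> b}\<close> be the clausal relation, and write \<open>L = {0..b}\<close> and
  \<open>U = {a..<n}\<close>. An operation \<open>f\<close> preserves \<open>R\<close> iff, whenever \<open>f x \<notin> U\<close> and \<open>f y \<notin> L\<close>, some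
  coordinate has \<open>x\<^sub>i \<notin> U\<close> and \<open>y\<^sub>i \<notin> L\<close>. Hence every operation with all values in \<open>L\<close>, and every
  operation with all values in \<open>U\<close>, belongs to \<open>Pol R\<close>, whatever it does otherwise. This makes
  \<open>Pol R\<close> large enough that very little has to be added to it to generate all operations.

  In each case let \<open>\<rho>\<close> be the relation named in the theorem (the order if \<open>n = 2\<close>). The whole argument rests on one
  generation property: a clone that contains \<open>Pol R\<close> and an operation \<open>f\<close> that does not
  preserve \<open>\<rho>\<close> contains all operations. As \<open>Pol R \<subseteq> Pol \<rho>\<close> and \<open>Pol \<rho>\<close> is a proper clone, this
  yields at once that \<open>Pol \<rho>\<close> is maximal and that it is the only maximal clone above \<open>Pol R\<close>
  (\<open>unique_maximal_clone_above\<close>).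

  To generate an arbitrary operation \<open>g\<close>, the operation \<open>f\<close> is first used to produce something
  simple that \<open>Pol R\<close> lacks, and this is then fed to a suitable \<open>F\<close> in \<open>Pol R\<close>:

  \<^item> If \<open>a > b + 1\<close>, then \<open>f\<close> maps a tuple over \<open>L \<union> U\<close> to some \<open>c\<close> strictly between \<open>L\<close> and \<open>U\<close>, and the
    constants in \<open>L \<union> U\<close> turn it into the constant operation \<open>c\<close>. There is an \<open>F\<close> in \<open>Pol R\<close> with
    \<open>F (c, z) = g z\<close> (\<open>gap_generation\<close>).
  \<^item> If \<open>a \<le> b + 1\<close> and \<open>n \<ge> 3\<close>, then \<open>\<theta>\<close> and \<open>\<sigma>\<close> are both \<open>L \<times> L \<union> U \<times> U\<close>. The operation \<open>f\<close>
    gives, for every set of arguments, a switch: an operation with a value below \<open>a\<close> on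
    this set and a value above \<open>b\<close> off it. A switch selects between the truncations
    \<open>min (g z) b\<close> and \<open>max (g z) a\<close>, which lie in \<open>Pol R\<close> (\<open>overlap_generation\<close>).
  \<^item> If \<open>n = 2\<close>, then \<open>R\<close> is the converse of the order, \<open>f\<close> gives negation, and \<open>g\<close> is a monotone
    operation of its arguments and their negations (\<open>boolean_generation\<close>).
\<close>

section \<open>Operations and clones\<close>

definition operation_of :: "nat \<Rightarrow> nat \<Rightarrow> (nat list \<Rightarrow> nat) \<Rightarrow> operation" where
  "operation_of n m h = (m, restrict h (tuples n m))"

lemma operation_of_cong:
  assumes "\<And>z. z \<in> tuples n m \<Longrightarrow> h z = h' z"
  shows "operation_of n m h = operation_of n m h'"
  using assms by (auto simp: operation_of_def restrict_def fun_eq_iff)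

lemma nth_tuples_less: "\<lbrakk>z \<in> tuples n k; i < k\<rbrakk> \<Longrightarrow> z ! i < n"
  unfolding tuples_def by (metis (mono_tags, lifting) lessThan_iff mem_Collect_eq nth_mem subsetD)

lemma map_upt_in_tuples: "(\<And>i. i < k \<Longrightarrow> h i < n) \<Longrightarrow> map h [0..<k] \<in> tuples n k"
  by (auto simp: tuples_def)

lemma map_nth_tuples: "x \<in> tuples n k \<Longrightarrow> map ((!) x) [0..<k] = x"
  by (auto simp: tuples_def map_nth)

lemma tuples_ext:
  assumes "x \<in> tuples n k" "y \<in> tuples n k" "\<And>i. i < k \<Longrightarrow> x ! i = y ! i"
  shows "x = y"
  using assms by (auto simp: tuples_def intro: nth_equalityI)

lemma operation_of_in_operations_iff:
  "operation_of n m h \<in> operations n \<longleftrightarrow> m \<ge> 1 \<and> (\<forall>z\<in>tuples n m. h z < n)"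
  by (auto simp: operation_of_def operations_def PiE_iff)

lemma operations_eq_operation_of: "(k, f) \<in> operations n \<Longrightarrow> (k, f) = operation_of n k f"
  by (auto simp: operation_of_def operations_def PiE_restrict)

lemma operations_cases:
  assumes "p \<in> operations n"
  obtains k f where "p = operation_of n k f" "k \<ge> 1" "\<And>z. z \<in> tuples n k \<Longrightarrow> f z < n"
proof -
  obtain k f where p: "p = (k, f)" by (cases p)
  then show thesis
    using that[of k f] operations_eq_operation_of[of k f n] operation_of_in_operations_iff[of n k f]
      assms by auto
qed

lemma clone_subset: "clone n K \<Longrightarrow> K \<subseteq> operations n"
  by (simp add: clone_def)

lemma clone_projection: "clone n K \<Longrightarrow> i < k \<Longrightarrow> operation_of n k (\<lambda>z. z ! i) \<in> K"
  by (auto simp: clone_def operation_of_def projection_def)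

lemma clone_composition:
  assumes K: "clone n K" and f: "operation_of n k f \<in> K"
    and H: "\<And>i. i < k \<Longrightarrow> operation_of n m (H i) \<in> K"
  shows "operation_of n m (\<lambda>z. f (map (\<lambda>i. H i z) [0..<k])) \<in> K"
proof -
  let ?gs = "map (\<lambda>i. restrict (H i) (tuples n m)) [0..<k]"
  have "composition n (restrict f (tuples n k)) m ?gs \<in> K"
    using K f H unfolding clone_def operation_of_def by auto
  moreover have "composition n (restrict f (tuples n k)) m ?gs =
      operation_of n m (\<lambda>z. restrict f (tuples n k) (map (\<lambda>i. H i z) [0..<k]))"
    unfolding composition_def operation_of_def by (auto simp: restrict_def fun_eq_iff comp_def)
  moreover have "\<dots> = operation_of n m (\<lambda>z. f (map (\<lambda>i. H i z) [0..<k]))"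
  proof (rule operation_of_cong)
    fix z assume z: "z \<in> tuples n m"
    have "H i z < n" if "i < k" for i
      using H[OF that] clone_subset[OF K] z operation_of_in_operations_iff by blast
    then show "restrict f (tuples n k) (map (\<lambda>i. H i z) [0..<k]) = f (map (\<lambda>i. H i z) [0..<k])"
      by (simp add: map_upt_in_tuples)
  qed
  ultimately show ?thesis by simp
qed

lemma preserves_row:
  assumes "preserves n (k, f) \<rho>" "length rs = k" "set rs \<subseteq> \<rho> \<inter> tuples n m"
  shows "map (\<lambda>i. f (map (\<lambda>r. r ! i) rs)) [0..<m] \<in> \<rho>"
  using assms by (auto simp: preserves_def)

lemma clone_Pol: "clone n (Pol n Q)"
  unfolding clone_def
proof (intro conjI allI impI)
  show "Pol n Q \<subseteq> operations n" by (auto simp: Pol_def)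
next
  fix k i :: nat assume i: "i < k"
  have "projection n k i \<in> operations n"
    using i by (auto simp: projection_def operations_def nth_tuples_less)
  moreover have "preserves n (projection n k i) \<rho>" for \<rho>
    unfolding projection_def preserves_def split
  proof (intro allI impI)
    fix m rs assume rs: "length rs = k \<and> set rs \<subseteq> \<rho> \<inter> tuples n m"
    then have ri: "rs ! i \<in> \<rho> \<inter> tuples n m" using i by (metis nth_mem subsetD)
    have "map (\<lambda>r. r ! j) rs \<in> tuples n k" if "j < m" for j
      using rs nth_tuples_less[OF _ that] by (auto simp: tuples_def[of n k])
    then have "map (\<lambda>j. restrict (\<lambda>xs. xs ! i) (tuples n k) (map (\<lambda>r. r ! j) rs)) [0..<m]
        = map ((!) (rs ! i)) [0..<m]"
      using rs i by auto
    also have "\<dots> = rs ! i" using map_nth_tuples ri by blast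
    finally show "map (\<lambda>j. restrict (\<lambda>xs. xs ! i) (tuples n k) (map (\<lambda>r. r ! j) rs)) [0..<m] \<in> \<rho>"
      using ri by simp
  qed
  ultimately show "projection n k i \<in> Pol n Q" by (simp add: Pol_def)
next
  fix k f m gs
  assume A: "(k, f) \<in> Pol n Q \<and> length gs = k \<and> (\<forall>g\<in>set gs. (m, g) \<in> Pol n Q)"
  then have f: "k \<ge> 1" "f \<in> tuples n k \<rightarrow>\<^sub>E {..<n}" by (auto simp: Pol_def operations_def)
  have g: "m \<ge> 1" "g \<in> tuples n m \<rightarrow>\<^sub>E {..<n}" if "g \<in> set gs" for g
    using A that by (auto simp: Pol_def operations_def)
  have "m \<ge> 1" using g(1) A f(1) by (metis One_nat_def Suc_le_length_iff list.set_intros(1))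
  have inner: "map (\<lambda>g. g xs) gs \<in> tuples n k" if "xs \<in> tuples n m" for xs
  proof -
    have "g xs < n" if "g \<in> set gs" for g using g(2)[OF that] \<open>xs \<in> tuples n m\<close> by auto
    then show ?thesis using A by (auto simp: tuples_def)
  qed
  have "composition n f m gs \<in> operations n"
    unfolding composition_def operations_def using \<open>m \<ge> 1\<close> inner f(2) by auto
  moreover have "preserves n (composition n f m gs) \<rho>" if \<rho>: "\<rho> \<in> Q" for \<rho>
    unfolding composition_def preserves_def split
  proof (intro allI impI)
    fix l rs assume rs: "length rs = m \<and> set rs \<subseteq> \<rho> \<inter> tuples n l"
    have col: "map (\<lambda>r. r ! i) rs \<in> tuples n m" if "i < l" for i
      using rs nth_tuples_less[OF _ that] by (auto simp: tuples_def[of n m])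
    let ?row = "\<lambda>g. map (\<lambda>i. g (map (\<lambda>r. r ! i) rs)) [0..<l]"
    have "?row g \<in> \<rho> \<inter> tuples n l" if "g \<in> set gs" for g
    proof
      have "preserves n (m, g) \<rho>" using A that \<rho> by (auto simp: Pol_def)
      then show "?row g \<in> \<rho>" using preserves_row rs by blast
      show "?row g \<in> tuples n l" using col g(2)[OF that] by (intro map_upt_in_tuples) auto
    qed
    then have "set (map ?row gs) \<subseteq> \<rho> \<inter> tuples n l" by auto
    moreover have "preserves n (k, f) \<rho>" using A \<rho> by (auto simp: Pol_def)
    ultimately have "map (\<lambda>i. f (map (\<lambda>r. r ! i) (map ?row gs))) [0..<l] \<in> \<rho>"
      using preserves_row A by (metis length_map)
    moreover have "map (\<lambda>i. f (map (\<lambda>r. r ! i) (map ?row gs))) [0..<l] =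
        map (\<lambda>i. restrict (\<lambda>xs. f (map (\<lambda>g. g xs) gs)) (tuples n m) (map (\<lambda>r. r ! i) rs)) [0..<l]"
      using col by (auto simp: comp_def)
    ultimately show "map (\<lambda>i. restrict (\<lambda>xs. f (map (\<lambda>g. g xs) gs)) (tuples n m)
        (map (\<lambda>r. r ! i) rs)) [0..<l] \<in> \<rho>" by (simp only:)
  qed
  ultimately show "composition n f m gs \<in> Pol n Q" by (simp add: Pol_def)
qed

text \<open>
  Any clone strictly above \<open>Pol n Q\<close> and any maximal clone above \<open>C\<close> other than \<open>Pol n Q\<close> both
  contain \<open>C\<close> and leave \<open>Pol n Q\<close>, so the generation hypothesis excludes them together.
\<close>

lemma unique_maximal_clone_above:
  assumes "C \<subseteq> Pol n Q" and "Pol n Q \<noteq> operations n"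
    and gen: "\<And>K. \<lbrakk>clone n K; C \<subseteq> K; \<not> K \<subseteq> Pol n Q\<rbrakk> \<Longrightarrow> operations n \<subseteq> K"
  shows "maximal_clone n (Pol n Q)" and "\<exists>!M. maximal_clone n M \<and> C \<subseteq> M"
proof -
  have proper: "Pol n Q \<subset> operations n" using assms(2) clone_subset[OF clone_Pol] by blast
  show max: "maximal_clone n (Pol n Q)"
    unfolding maximal_clone_def using proper clone_Pol gen assms(1) by blast
  show "\<exists>!M. maximal_clone n M \<and> C \<subseteq> M"
  proof (rule ex1I[of _ "Pol n Q"])
    fix M assume M: "maximal_clone n M \<and> C \<subseteq> M"
    then have "M \<subseteq> Pol n Q" using gen[of M] unfolding maximal_clone_def by blast
    then show "M = Pol n Q" using M proper clone_Pol unfolding maximal_clone_def by blast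
  qed (use max assms(1) in blast)
qed

section \<open>Preservation of unary and binary relations\<close>

lemma binary_rel_iff [simp]: "[x, y] \<in> binary_rel r \<longleftrightarrow> (x, y) \<in> r"
  by (auto simp: binary_rel_def)

lemma unary_rel_iff [simp]: "[x] \<in> unary_rel A \<longleftrightarrow> x \<in> A"
  by (auto simp: unary_rel_def)

lemma upt_0_2: "[0..<2] = [0, 1]"
  by (simp add: upt_rec)

lemma preserves_binary_rel_iff:
  assumes k: "k \<ge> 1" and r: "r \<subseteq> {..<n} \<times> {..<n}"
  shows "preserves n (k, f) (binary_rel r) \<longleftrightarrow>
    (\<forall>x\<in>tuples n k. \<forall>y\<in>tuples n k. (\<forall>i<k. (x ! i, y ! i) \<in> r) \<longrightarrow> (f x, f y) \<in> r)"
    (is "?l \<longleftrightarrow> ?r")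
proof
  assume ?l
  show ?r
  proof (intro ballI impI)
    fix x y assume x: "x \<in> tuples n k" and y: "y \<in> tuples n k" and xy: "\<forall>i<k. (x ! i, y ! i) \<in> r"
    let ?rs = "map (\<lambda>i. [x ! i, y ! i]) [0..<k]"
    have "set ?rs \<subseteq> binary_rel r \<inter> tuples n 2"
      using xy nth_tuples_less[OF x] nth_tuples_less[OF y] by (auto simp: tuples_def)
    from preserves_row[OF \<open>?l\<close> _ this]
    have "[f (map (\<lambda>r. r ! 0) ?rs), f (map (\<lambda>r. r ! 1) ?rs)] \<in> binary_rel r"
      by (simp add: upt_0_2)
    moreover have "map (\<lambda>r. r ! 0) ?rs = x" "map (\<lambda>r. r ! 1) ?rs = y"
      using x y by (auto simp: comp_def map_nth_tuples)
    ultimately show "(f x, f y) \<in> r" by simp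
  qed
next
  assume R: ?r
  show ?l unfolding preserves_def split
  proof (intro allI impI)
    fix m rs assume rs: "length rs = k \<and> set rs \<subseteq> binary_rel r \<inter> tuples n m"
    have row: "rs ! i \<in> binary_rel r \<inter> tuples n m" if "i < k" for i
      using rs that by (metis nth_mem subsetD)
    have m: "m = 2" using row[of 0] k by (auto simp: binary_rel_def tuples_def)
    have pair: "(rs ! i ! 0, rs ! i ! 1) \<in> r" if "i < k" for i
      using row[OF that] by (auto simp: binary_rel_def)
    let ?x = "map (\<lambda>r. r ! 0) rs" and ?y = "map (\<lambda>r. r ! 1) rs"
    have "r ! 0 < n \<and> r ! 1 < n" if "r \<in> set rs" for r
      using rs m that nth_tuples_less[of r n 2] by auto
    then have "?x \<in> tuples n k" "?y \<in> tuples n k"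
      using rs by (auto simp: tuples_def)
    then have "(f ?x, f ?y) \<in> r" using R pair rs by (auto simp del: One_nat_def)
    then show "map (\<lambda>i. f (map (\<lambda>r. r ! i) rs)) [0..<m] \<in> binary_rel r"
      by (simp add: m upt_0_2)
  qed
qed

lemma preserves_unary_rel_iff:
  assumes k: "k \<ge> 1" and A: "A \<subseteq> {..<n}"
  shows "preserves n (k, f) (unary_rel A) \<longleftrightarrow>
    (\<forall>x\<in>tuples n k. (\<forall>i<k. x ! i \<in> A) \<longrightarrow> f x \<in> A)"
    (is "?l \<longleftrightarrow> ?r")
proof
  assume ?l
  show ?r
  proof (intro ballI impI)
    fix x assume x: "x \<in> tuples n k" and xA: "\<forall>i<k. x ! i \<in> A"
    let ?rs = "map (\<lambda>i. [x ! i]) [0..<k]"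
    have "set ?rs \<subseteq> unary_rel A \<inter> tuples n 1"
      using xA nth_tuples_less[OF x] by (auto simp: tuples_def)
    from preserves_row[OF \<open>?l\<close> _ this]
    have "[f (map (\<lambda>r. r ! 0) ?rs)] \<in> unary_rel A"
      by simp
    moreover have "map (\<lambda>r. r ! 0) ?rs = x"
      using x by (auto simp: comp_def map_nth_tuples)
    ultimately show "f x \<in> A" by simp
  qed
next
  assume R: ?r
  show ?l unfolding preserves_def split
  proof (intro allI impI)
    fix m rs assume rs: "length rs = k \<and> set rs \<subseteq> unary_rel A \<inter> tuples n m"
    have row: "rs ! i \<in> unary_rel A \<inter> tuples n m" if "i < k" for i
      using rs that by (metis nth_mem subsetD)
    have m: "m = 1" using row[of 0] k by (auto simp: unary_rel_def tuples_def)
    have elem: "rs ! i ! 0 \<in> A" if "i < k" for i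
      using row[OF that] by (auto simp: unary_rel_def)
    let ?x = "map (\<lambda>r. r ! 0) rs"
    have "r ! 0 < n" if "r \<in> set rs" for r
      using rs m that nth_tuples_less[of r n 1] by auto
    then have "?x \<in> tuples n k"
      using rs by (auto simp: tuples_def)
    then have "f ?x \<in> A" using R elem rs by auto
    then show "map (\<lambda>i. f (map (\<lambda>r. r ! i) rs)) [0..<m] \<in> unary_rel A"
      by (simp add: m)
  qed
qed

lemma operation_of_in_Pol_binary_iff:
  assumes "r \<subseteq> {..<n} \<times> {..<n}"
  shows "operation_of n k f \<in> Pol n {binary_rel r} \<longleftrightarrow>
    k \<ge> 1 \<and> (\<forall>x\<in>tuples n k. f x < n) \<and>
    (\<forall>x\<in>tuples n k. \<forall>y\<in>tuples n k. (\<forall>i<k. (x ! i, y ! i) \<in> r) \<longrightarrow> (f x, f y) \<in> r)"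
proof (cases "k \<ge> 1")
  case True
  show ?thesis
    using preserves_binary_rel_iff[OF True assms, of "restrict f (tuples n k)"]
      operation_of_in_operations_iff[of n k f]
    by (auto simp: Pol_def operation_of_def)
next
  case False
  then show ?thesis by (auto simp: Pol_def operation_of_in_operations_iff)
qed

lemma operation_of_in_Pol_unary_iff:
  assumes "A \<subseteq> {..<n}"
  shows "operation_of n k f \<in> Pol n {unary_rel A} \<longleftrightarrow>
    k \<ge> 1 \<and> (\<forall>x\<in>tuples n k. f x < n) \<and>
    (\<forall>x\<in>tuples n k. (\<forall>i<k. x ! i \<in> A) \<longrightarrow> f x \<in> A)"
proof (cases "k \<ge> 1")
  case True
  show ?thesis
    using preserves_unary_rel_iff[OF True assms, of "restrict f (tuples n k)"]
      operation_of_in_operations_iff[of n k f]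
    by (auto simp: Pol_def operation_of_def)
next
  case False
  then show ?thesis by (auto simp: Pol_def operation_of_in_operations_iff)
qed

section \<open>Polymorphisms of the clausal relation\<close>

lemma clausal_rel_eq_binary_rel:
  "clausal_rel n [a] [b] = binary_rel {(x, y). x < n \<and> y < n \<and> (a \<le> x \<or> y \<le> b)}"
proof -
  have "tuples n 1 = {[x] | x. x < n}"
    by (auto simp: tuples_def length_Suc_conv)
  then have one: "tuples n (length [c]) = {[x] | x. x < n}" for c :: nat by simp
  have "(\<exists>u v. w = u @ v \<and> (\<exists>x<n. u = [x]) \<and> (\<exists>y<n. v = [y]) \<and> (a \<le> u ! 0 \<or> v ! 0 \<le> b)) \<longleftrightarrow>
      (\<exists>x y. w = [x] @ [y] \<and> x < n \<and> y < n \<and> (a \<le> x \<or> y \<le> b))" for w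
    by (metis nth_Cons_0)
  then show ?thesis
    unfolding clausal_rel_def binary_rel_def one by (simp add: conj_commute)
qed

text \<open>
  The contrapositive form of preservation: a pair of values outside the relation must already
  show in some coordinate.
\<close>

lemma operation_of_in_Pol_clausal_iff:
  "operation_of n k f \<in> Pol n {clausal_rel n [a] [b]} \<longleftrightarrow>
    k \<ge> 1 \<and> (\<forall>x\<in>tuples n k. f x < n) \<and>
    (\<forall>x\<in>tuples n k. \<forall>y\<in>tuples n k. f x < a \<and> b < f y \<longrightarrow> (\<exists>i<k. x ! i < a \<and> b < y ! i))"
proof -
  let ?R = "{(x, y). x < n \<and> y < n \<and> (a \<le> x \<or> y \<le> b)}"
  have R: "?R \<subseteq> {..<n} \<times> {..<n}" by auto
  have conv: "(c, d) \<in> ?R \<longleftrightarrow> \<not> (c < a \<and> b < d)" if "c < n" "d < n" for c d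
    using that by auto
  have "(\<forall>i<k. (x ! i, y ! i) \<in> ?R) \<longleftrightarrow> \<not> (\<exists>i<k. x ! i < a \<and> b < y ! i)"
    if "x \<in> tuples n k" "y \<in> tuples n k" for x y
    using conv nth_tuples_less[OF that(1)] nth_tuples_less[OF that(2)] by blast
  then show ?thesis
    unfolding clausal_rel_eq_binary_rel operation_of_in_Pol_binary_iff[OF R]
    using conv by blast
qed

lemma low_operation_in_Pol_clausal:
  assumes "m \<ge> 1" "b < n" "\<And>z. z \<in> tuples n m \<Longrightarrow> h z \<le> b"
  shows "operation_of n m h \<in> Pol n {clausal_rel n [a] [b]}"
  unfolding operation_of_in_Pol_clausal_iff using assms by (meson leD le_less_trans)

lemma high_operation_in_Pol_clausal:
  assumes "m \<ge> 1" "\<And>z. z \<in> tuples n m \<Longrightarrow> a \<le> h z \<and> h z < n"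
  shows "operation_of n m h \<in> Pol n {clausal_rel n [a] [b]}"
  unfolding operation_of_in_Pol_clausal_iff using assms by (meson leD)

section \<open>A gap between the two parts\<close>

lemma Pol_clausal_subset_gap:
  assumes "a < n" "b < n"
  shows "Pol n {clausal_rel n [a] [b]} \<subseteq> Pol n {unary_rel ({0..b} \<union> {a..<n})}"
proof
  fix p assume p: "p \<in> Pol n {clausal_rel n [a] [b]}"
  then have "p \<in> operations n" by (simp add: Pol_def)
  then obtain k f where pk: "p = operation_of n k f" by (rule operations_cases)
  have sub: "{0..b} \<union> {a..<n} \<subseteq> {..<n}" using assms by auto
  have F: "k \<ge> 1" "\<And>x. x \<in> tuples n k \<Longrightarrow> f x < n"
    "\<And>x. x \<in> tuples n k \<Longrightarrow> f x < a \<Longrightarrow> b < f x \<Longrightarrow> \<exists>i<k. x ! i < a \<and> b < x ! i"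
    using p unfolding pk operation_of_in_Pol_clausal_iff by blast+
  have "f x \<in> {0..b} \<union> {a..<n}"
    if x: "x \<in> tuples n k" "\<forall>i<k. x ! i \<in> {0..b} \<union> {a..<n}" for x
  proof (rule ccontr)
    assume "f x \<notin> {0..b} \<union> {a..<n}"
    then have "f x < a" "b < f x" using F(2)[OF x(1)] by auto
    then obtain i where "i < k" "x ! i < a" "b < x ! i" using F(3) x(1) by blast
    then show False using x(2) by auto
  qed
  then show "p \<in> Pol n {unary_rel ({0..b} \<union> {a..<n})}"
    unfolding pk operation_of_in_Pol_unary_iff[OF sub] using F by blast
qed

text \<open>
  Over tuples from \<open>{0..b} \<union> {a..<n}\<close> the given operation yields a constant \<open>c\<close> strictly inside
  the gap. Such a constant can switch on an arbitrary operation \<open>g\<close>: the pair \<open>(c, c)\<close> lies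
  outside the clausal relation, so \<open>g\<close> is unconstrained where the first argument is \<open>c\<close>.
\<close>

lemma gap_generation:
  assumes a: "a < n" and b: "b < n" and ab: "b + 1 < a"
    and K: "clone n K" and sub: "Pol n {clausal_rel n [a] [b]} \<subseteq> K"
    and out: "\<not> K \<subseteq> Pol n {unary_rel ({0..b} \<union> {a..<n})}"
  shows "operations n \<subseteq> K"
proof
  fix p assume "p \<in> operations n"
  then obtain m g where p: "p = operation_of n m g" and m: "m \<ge> 1"
    and g: "\<And>z. z \<in> tuples n m \<Longrightarrow> g z < n" by (rule operations_cases) blast
  obtain q where q: "q \<in> K" "q \<notin> Pol n {unary_rel ({0..b} \<union> {a..<n})}" using out by blast
  then have "q \<in> operations n" using clone_subset[OF K] by blast
  then obtain k f where qf: "q = operation_of n k f" and k: "k \<ge> 1"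
    and f: "\<And>z. z \<in> tuples n k \<Longrightarrow> f z < n" by (rule operations_cases) blast
  have "{0..b} \<union> {a..<n} \<subseteq> {..<n}" using a b by auto
  then obtain x where x: "x \<in> tuples n k" "\<forall>i<k. x ! i \<in> {0..b} \<union> {a..<n}"
      "f x \<notin> {0..b} \<union> {a..<n}"
    using q(2) k f unfolding qf by (auto simp: operation_of_in_Pol_unary_iff)
  define c where "c = f x"
  have c: "b < c" "c < a" using x(3) f[OF x(1)] by (auto simp: c_def)
  have "operation_of n m (\<lambda>z. x ! i) \<in> K" if "i < k" for i
  proof (cases "x ! i \<le> b")
    case True
    then show ?thesis using low_operation_in_Pol_clausal[OF m b, of "\<lambda>z. x ! i" a] sub by auto
  next
    case False
    then have "a \<le> x ! i \<and> x ! i < n" using x(2) that by auto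
    then show ?thesis using high_operation_in_Pol_clausal[OF m, of n a "\<lambda>z. x ! i" b] sub by auto
  qed
  then have "operation_of n m (\<lambda>z. f (map (\<lambda>i. x ! i) [0..<k])) \<in> K"
    using clone_composition[OF K, of k f m "\<lambda>i z. x ! i"] q(1) qf by blast
  then have const: "operation_of n m (\<lambda>z. c) \<in> K"
    using x(1) by (simp add: map_nth_tuples c_def)
  \<comment> \<open>Off \<open>c\<close>, the value of \<open>F\<close> is the end of \<open>{0..<n}\<close> on the side of \<open>t\<close>. Thus a value below \<open>a\<close>
    forces \<open>t < a\<close> and a value above \<open>b\<close> forces \<open>b < t\<close>: the first coordinate alone shows that
    \<open>F\<close> is in the polymorphism clone.\<close>
  define F where "F u = (if a \<le> hd u then n - 1 else if hd u = c then g (tl u) else 0)" for u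
  have tl: "hd u = u ! 0 \<and> tl u \<in> tuples n m" if "u \<in> tuples n (Suc m)" for u
    using that by (cases u) (auto simp: tuples_def)
  have "operation_of n (Suc m) F \<in> Pol n {clausal_rel n [a] [b]}"
    unfolding operation_of_in_Pol_clausal_iff
  proof (intro conjI ballI impI)
    fix u assume "u \<in> tuples n (Suc m)"
    then show "F u < n" using tl g a by (auto simp: F_def)
  next
    fix u v assume "u \<in> tuples n (Suc m)" "v \<in> tuples n (Suc m)" "F u < a \<and> b < F v"
    then have "u ! 0 < a \<and> b < v ! 0"
      using tl[of u] tl[of v] a ab c by (auto simp: F_def split: if_splits)
    then show "\<exists>i<Suc m. u ! i < a \<and> b < v ! i" by blast
  qed simp
  then have F: "operation_of n (Suc m) F \<in> K" using sub by blast
  let ?H = "\<lambda>i z. if i = 0 then c else z ! (i - 1)"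
  have "operation_of n m (?H i) \<in> K" if "i < Suc m" for i
    using const clone_projection[OF K, of "i - 1" m] that by (cases i) auto
  from clone_composition[OF K F this]
  have "operation_of n m (\<lambda>z. F (map (\<lambda>i. ?H i z) [0..<Suc m])) \<in> K" .
  moreover have "F (map (\<lambda>i. ?H i z) [0..<Suc m]) = g z" if "z \<in> tuples n m" for z
  proof -
    have "map (\<lambda>i. ?H i z) [0..<Suc m] = c # z"
      using map_nth_tuples[OF that] by (simp add: upt_conv_Cons[of 0 "Suc m"] map_Suc_upt[symmetric] comp_def del: upt_Suc)
    then show ?thesis using c by (simp add: F_def)
  qed
  ultimately show "p \<in> K" unfolding p by (metis (no_types, lifting) operation_of_cong)
qed

lemma Pol_gap_proper:
  assumes "a < n" "b + 1 < a"
  shows "Pol n {unary_rel ({0..b} \<union> {a..<n})} \<noteq> operations n"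
proof -
  have "{0..b} \<union> {a..<n} \<subseteq> {..<n}" using assms by auto
  moreover have "[0] \<in> tuples n 1" using assms by (auto simp: tuples_def)
  ultimately have "operation_of n 1 (\<lambda>_. b + 1) \<notin> Pol n {unary_rel ({0..b} \<union> {a..<n})}"
    using assms by (auto simp: operation_of_in_Pol_unary_iff intro!: bexI[of _ "[0]"])
  moreover have "operation_of n 1 (\<lambda>_. b + 1) \<in> operations n"
    using assms by (auto simp: operation_of_in_operations_iff)
  ultimately show ?thesis by blast
qed

section \<open>Two parts that cover the domain\<close>

lemma Pol_clausal_subset_overlap:
  assumes "a < n" "b < n" "a \<le> b + 1"
  shows "Pol n {clausal_rel n [a] [b]} \<subseteq>
    Pol n {binary_rel ({0..b} \<times> {0..b} \<union> {a..<n} \<times> {a..<n})}"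
proof
  let ?r = "{0..b} \<times> {0..b} \<union> {a..<n} \<times> {a..<n}"
  fix p assume p: "p \<in> Pol n {clausal_rel n [a] [b]}"
  then have "p \<in> operations n" by (simp add: Pol_def)
  then obtain k f where pk: "p = operation_of n k f" by (rule operations_cases)
  have sub: "?r \<subseteq> {..<n} \<times> {..<n}" using assms by auto
  have F: "k \<ge> 1" "\<And>x. x \<in> tuples n k \<Longrightarrow> f x < n"
    "\<And>x y. x \<in> tuples n k \<Longrightarrow> y \<in> tuples n k \<Longrightarrow> f x < a \<Longrightarrow> b < f y \<Longrightarrow>
      \<exists>i<k. x ! i < a \<and> b < y ! i"
    using p unfolding pk operation_of_in_Pol_clausal_iff by blast+
  have *: False if *: "x \<in> tuples n k" "y \<in> tuples n k" "\<forall>i<k. (x ! i, y ! i) \<in> ?r"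
    "f x < a" "b < f y" for x y
  proof -
    obtain i where "i < k" "x ! i < a" "b < y ! i" using F(3) * by blast
    then show False using *(3) by auto
  qed
  have "(f x, f y) \<in> ?r"
    if x: "x \<in> tuples n k" and y: "y \<in> tuples n k" and xy: "\<forall>i<k. (x ! i, y ! i) \<in> ?r" for x y
  proof (rule ccontr)
    assume "(f x, f y) \<notin> ?r"
    then have "f x < a \<and> b < f y \<or> f y < a \<and> b < f x"
      using F(2)[OF x] F(2)[OF y] assms by auto
    moreover have "\<forall>i<k. (y ! i, x ! i) \<in> ?r" using xy by auto
    ultimately show False using *[OF x y xy] *[OF y x] by blast
  qed
  then show "p \<in> Pol n {binary_rel ?r}"
    unfolding pk operation_of_in_Pol_binary_iff[OF sub] using F by blast
qed

text \<open>
  The given operation \<open>f\<close> takes a value below \<open>a\<close> at a tuple \<open>x\<close> and a value above \<open>b\<close> at a tuple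
  \<open>y\<close>, although \<open>x\<^sub>i\<close> and \<open>y\<^sub>i\<close> always lie in a common part. So a choice between \<open>x\<^sub>i\<close> and \<open>y\<^sub>i\<close>
  that depends arbitrarily on the arguments stays inside one part, hence inside the
  polymorphism clone, and \<open>f\<close> turns these choices into a switch.
\<close>

lemma overlap_generation:
  assumes a: "a < n" and b: "b < n" and ab: "a \<le> b + 1"
    and K: "clone n K" and sub: "Pol n {clausal_rel n [a] [b]} \<subseteq> K"
    and out: "\<not> K \<subseteq> Pol n {binary_rel ({0..b} \<times> {0..b} \<union> {a..<n} \<times> {a..<n})}"
  shows "operations n \<subseteq> K"
proof
  let ?r = "{0..b} \<times> {0..b} \<union> {a..<n} \<times> {a..<n}"
  fix p assume "p \<in> operations n"
  then obtain m g where p: "p = operation_of n m g" and m: "m \<ge> 1"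
    and g: "\<And>z. z \<in> tuples n m \<Longrightarrow> g z < n" by (rule operations_cases) blast
  obtain q where q: "q \<in> K" "q \<notin> Pol n {binary_rel ?r}" using out by blast
  then have "q \<in> operations n" using clone_subset[OF K] by blast
  then obtain k f where qf: "q = operation_of n k f" and k: "k \<ge> 1"
    and f: "\<And>z. z \<in> tuples n k \<Longrightarrow> f z < n" by (rule operations_cases) blast
  have "?r \<subseteq> {..<n} \<times> {..<n}" using a b by auto
  then obtain u v where uv: "u \<in> tuples n k" "v \<in> tuples n k" "\<forall>i<k. (u ! i, v ! i) \<in> ?r"
      "(f u, f v) \<notin> ?r"
    using q(2) k f unfolding qf operation_of_in_Pol_binary_iff[OF \<open>?r \<subseteq> _\<close>] by blast
  obtain x y where xy: "x \<in> tuples n k" "y \<in> tuples n k" "\<forall>i<k. (x ! i, y ! i) \<in> ?r"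
      "f x < a" "b < f y"
  proof (cases "f u < a \<and> b < f v")
    case True
    then show thesis using that[of u v] uv by blast
  next
    case False
    then have "f v < a \<and> b < f u" using uv(4) f[OF uv(1)] f[OF uv(2)] ab by auto
    moreover have "\<forall>i<k. (v ! i, u ! i) \<in> ?r" using uv(3) by auto
    ultimately show thesis using that[of v u] uv(1,2) by blast
  qed
  let ?s = "\<lambda>z. if g z < a then f x else f y"
  let ?c = "\<lambda>i z. if g z < a then x ! i else y ! i"
  have "operation_of n m (?c i) \<in> K" if "i < k" for i
  proof (cases "x ! i \<le> b \<and> y ! i \<le> b")
    case True
    then show ?thesis using low_operation_in_Pol_clausal[OF m b, of "?c i" a] sub by auto
  next
    case False
    then have "a \<le> x ! i \<and> x ! i < n \<and> a \<le> y ! i \<and> y ! i < n" using xy(3) that by auto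
    then show ?thesis using high_operation_in_Pol_clausal[OF m, of n a "?c i" b] sub by auto
  qed
  then have "operation_of n m (\<lambda>z. f (map (\<lambda>i. ?c i z) [0..<k])) \<in> K"
    using clone_composition[OF K, of k f m ?c] q(1) qf by blast
  moreover have "f (map (\<lambda>i. ?c i z) [0..<k]) = ?s z" for z
    using map_nth_tuples[OF xy(1)] map_nth_tuples[OF xy(2)] by simp
  ultimately have switch: "operation_of n m ?s \<in> K" by simp
  have low: "operation_of n m (\<lambda>z. min (g z) b) \<in> K"
    using low_operation_in_Pol_clausal[OF m b, of "\<lambda>z. min (g z) b" a] sub by auto
  have high: "operation_of n m (\<lambda>z. max (g z) a) \<in> K"
    using high_operation_in_Pol_clausal[OF m, of n a "\<lambda>z. max (g z) a" b] g a sub by auto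
  \<comment> \<open>The selector truncates its data arguments once more, so that for all inputs a value below
    \<open>a\<close> forces the first argument below \<open>a\<close>, and a value above \<open>b\<close> forces it above \<open>b\<close>. The default
    \<open>a\<close> arises only if \<open>a \<le> b\<close>, and then it is neither below \<open>a\<close> nor above \<open>b\<close>.\<close>
  define F where "F w = (if w ! 0 < a then min (w ! 1) b
    else if b < w ! 0 then max (w ! 2) a else a)" for w :: "nat list"
  have "operation_of n 3 F \<in> Pol n {clausal_rel n [a] [b]}"
    unfolding operation_of_in_Pol_clausal_iff
  proof (intro conjI ballI impI)
    fix w assume "w \<in> tuples n 3"
    then have "w ! 1 < n" "w ! 2 < n" using nth_tuples_less[of w n 3] by auto
    then show "F w < n" using a b by (auto simp: F_def)
  next
    fix w w' assume "w \<in> tuples n 3" "w' \<in> tuples n 3" "F w < a \<and> b < F w'"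
    then have "w ! 0 < a \<and> b < w' ! 0"
      using ab by (auto simp: F_def split: if_splits)
    then show "\<exists>i<3. w ! i < a \<and> b < w' ! i" by (intro exI[of _ 0]) auto
  qed simp
  then have F: "operation_of n 3 F \<in> K" using sub by blast
  let ?H = "\<lambda>i. [?s, \<lambda>z. min (g z) b, \<lambda>z. max (g z) a] ! i"
  have "operation_of n m (?H i) \<in> K" if "i < 3" for i
  proof -
    have "i = 0 \<or> i = 1 \<or> i = 2" using that by auto
    then show ?thesis using switch low high by auto
  qed
  from clone_composition[OF K F this]
  have "operation_of n m (\<lambda>z. F (map (\<lambda>i. ?H i z) [0..<3])) \<in> K" .
  moreover have "F (map (\<lambda>i. ?H i z) [0..<3]) = g z" for z
    using xy(4,5) ab by (auto simp: F_def upt_rec)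
  ultimately show "p \<in> K" unfolding p by simp
qed

text \<open>
  With at least three elements one of the two parts contains two distinct elements, and these
  can be mapped to \<open>0\<close> and \<open>n - 1\<close>, which share no part. (With two elements the relation would be
  the identity, which every operation preserves.)
\<close>

lemma Pol_overlap_proper:
  assumes n: "n \<ge> 3" and a: "0 < a" "a < n" and b: "b < n - 1" and ab: "a \<le> b + 1"
  shows "Pol n {binary_rel ({0..b} \<times> {0..b} \<union> {a..<n} \<times> {a..<n})} \<noteq> operations n"
proof -
  let ?r = "{0..b} \<times> {0..b} \<union> {a..<n} \<times> {a..<n}"
  obtain d e where de: "d \<noteq> e" "(d, e) \<in> ?r"
  proof (cases "b = 0")
    case True
    then have "(1, 2) \<in> ?r" using a n ab by auto
    then show thesis using that[of 1 2] by simp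
  next
    case False
    then show thesis using that[of 0 b] by simp
  qed
  have r: "?r \<subseteq> {..<n} \<times> {..<n}" using a b by auto
  let ?f = "\<lambda>z. if z ! 0 = d then 0 else n - 1"
  have "[d] \<in> tuples n 1" "[e] \<in> tuples n 1" using de(2) a b by (auto simp: tuples_def)
  moreover have "\<forall>i<1. ([d] ! i, [e] ! i) \<in> ?r" using de(2) by simp
  moreover have "(?f [d], ?f [e]) \<notin> ?r" using de(1) a b by auto
  ultimately have "operation_of n 1 ?f \<notin> Pol n {binary_rel ?r}"
    unfolding operation_of_in_Pol_binary_iff[OF r] by blast
  moreover have "operation_of n 1 ?f \<in> operations n"
    using n by (auto simp: operation_of_in_operations_iff)
  ultimately show ?thesis by blast
qed

section \<open>Two elements\<close>

lemma leq_rel_subset: "leq_rel n \<subseteq> {..<n} \<times> {..<n}"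
  by (auto simp: leq_rel_def)

lemma Pol_clausal_eq_Pol_leq: "Pol 2 {clausal_rel 2 [1] [0]} = Pol 2 {binary_rel (leq_rel 2)}"
proof -
  let ?P = "\<lambda>k f. \<forall>x\<in>tuples 2 k. \<forall>y\<in>tuples 2 k. f x < 1 \<and> 0 < f y \<longrightarrow>
      (\<exists>i<k. x ! i < 1 \<and> 0 < y ! i)"
  let ?Q = "\<lambda>k f. \<forall>x\<in>tuples 2 k. \<forall>y\<in>tuples 2 k. (\<forall>i<k. (x ! i, y ! i) \<in> leq_rel 2) \<longrightarrow>
      (f x, f y) \<in> leq_rel 2"
  have conv: "(x, y) \<in> leq_rel 2 \<longleftrightarrow> \<not> (y < 1 \<and> 0 < x)" if "x < 2" "y < 2" for x y :: nat
    using that by (auto simp: leq_rel_def)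
  have "?P k f \<longleftrightarrow> ?Q k f" if f: "\<forall>x\<in>tuples 2 k. f x < 2" for k f
  proof -
    have "(\<forall>i<k. (x ! i, y ! i) \<in> leq_rel 2) \<longleftrightarrow> \<not> (\<exists>i<k. y ! i < 1 \<and> 0 < x ! i)"
      if "x \<in> tuples 2 k" "y \<in> tuples 2 k" for x y
      using conv nth_tuples_less[OF that(1)] nth_tuples_less[OF that(2)] by blast
    moreover have "(f x, f y) \<in> leq_rel 2 \<longleftrightarrow> \<not> (f y < 1 \<and> 0 < f x)"
      if "x \<in> tuples 2 k" "y \<in> tuples 2 k" for x y
      using conv f that by blast
    ultimately show ?thesis by blast
  qed
  then have *: "operation_of 2 k f \<in> Pol 2 {clausal_rel 2 [1] [0]} \<longleftrightarrow>
      operation_of 2 k f \<in> Pol 2 {binary_rel (leq_rel 2)}" for k f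
    unfolding operation_of_in_Pol_clausal_iff operation_of_in_Pol_binary_iff[OF leq_rel_subset]
    by blast
  show ?thesis
  proof (rule set_eqI)
    fix p
    show "p \<in> Pol 2 {clausal_rel 2 [1] [0]} \<longleftrightarrow> p \<in> Pol 2 {binary_rel (leq_rel 2)}"
    proof (cases "p \<in> operations 2")
      case True
      then show ?thesis using * by (metis operations_cases)
    qed (auto simp: Pol_def)
  qed
qed

text \<open>
  Let \<open>f\<close> be not monotone, with \<open>x \<le> y\<close>, \<open>f x = 1\<close> and \<open>f y = 0\<close>. Composing \<open>f\<close> with the monotone
  unary operations that map \<open>0\<close> to \<open>x\<^sub>i\<close> and \<open>1\<close> to \<open>y\<^sub>i\<close> gives negation. The tuples
  \<open>z\<close> followed by its negation form an antichain, so that a monotone operation can take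
  arbitrary values on them.
\<close>

lemma boolean_generation:
  assumes K: "clone 2 K" and sub: "Pol 2 {binary_rel (leq_rel 2)} \<subseteq> K"
    and out: "\<not> K \<subseteq> Pol 2 {binary_rel (leq_rel 2)}"
  shows "operations 2 \<subseteq> K"
proof
  fix p :: operation assume "p \<in> operations 2"
  then obtain m g where p: "p = operation_of 2 m g" and m: "m \<ge> 1"
    and g: "\<And>z. z \<in> tuples 2 m \<Longrightarrow> g z < 2" by (rule operations_cases) blast
  obtain q where q: "q \<in> K" "q \<notin> Pol 2 {binary_rel (leq_rel 2)}" using out by blast
  then have "q \<in> operations 2" using clone_subset[OF K] by blast
  then obtain k f where qf: "q = operation_of 2 k f" and k: "k \<ge> 1"
    and f: "\<And>z. z \<in> tuples 2 k \<Longrightarrow> f z < 2" by (rule operations_cases) blast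
  obtain x y where xy: "x \<in> tuples 2 k" "y \<in> tuples 2 k"
      "\<forall>i<k. (x ! i, y ! i) \<in> leq_rel 2" "(f x, f y) \<notin> leq_rel 2"
    using q(2) k f unfolding qf operation_of_in_Pol_binary_iff[OF leq_rel_subset] by blast
  have fxy: "f x = 1" "f y = 0" using xy(4) f[OF xy(1)] f[OF xy(2)] by (auto simp: leq_rel_def)
  let ?c = "\<lambda>i z. if z ! 0 = 0 then x ! i else y ! i"
  have "operation_of 2 1 (?c i) \<in> K" if "i < k" for i
  proof -
    have "(x ! i, y ! i) \<in> leq_rel 2" using xy(3) that by blast
    then have "operation_of 2 1 (?c i) \<in> Pol 2 {binary_rel (leq_rel 2)}"
      unfolding operation_of_in_Pol_binary_iff[OF leq_rel_subset] by (auto simp: leq_rel_def)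
    then show ?thesis using sub by blast
  qed
  then have "operation_of 2 1 (\<lambda>z. f (map (\<lambda>i. ?c i z) [0..<k])) \<in> K"
    using clone_composition[OF K, of k f 1 ?c] q(1) qf by blast
  moreover have "f (map (\<lambda>i. ?c i z) [0..<k]) = (if z ! 0 = 0 then 1 else 0)" for z :: "nat list"
    using map_nth_tuples[OF xy(1)] map_nth_tuples[OF xy(2)] fxy by simp
  ultimately have neg: "operation_of 2 1 (\<lambda>z. if z ! 0 = 0 then 1 else 0) \<in> K" by simp
  define H where "H i z = (if i < m then z ! i else if z ! (i - m) = 0 then 1 else 0)"
    for i and z :: "nat list"
  have HK: "operation_of 2 m (H i) \<in> K" if "i < 2 * m" for i
  proof (cases "i < m")
    case True
    then have "H i = (\<lambda>z. z ! i)" by (auto simp: H_def)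
    then show ?thesis using clone_projection[OF K True] by simp
  next
    case False
    then have "H i = (\<lambda>z. if map (\<lambda>_. z ! (i - m)) [0..<1] ! 0 = 0 then 1 else 0)"
      by (auto simp: H_def)
    moreover have "operation_of 2 m (\<lambda>z. z ! (i - m)) \<in> K"
      using clone_projection[OF K, of "i - m" m] False that by simp
    ultimately show ?thesis
      using clone_composition[OF K neg, of m "\<lambda>_ z. z ! (i - m)"] by simp
  qed
  define F where "F u = (if \<exists>t\<in>tuples 2 m. g t = 1 \<and> (\<forall>i<2 * m. H i t \<le> u ! i) then 1 else 0 :: nat)"
    for u
  have "operation_of 2 (2 * m) F \<in> Pol 2 {binary_rel (leq_rel 2)}"
    unfolding operation_of_in_Pol_binary_iff[OF leq_rel_subset]
  proof (intro conjI ballI impI)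
    fix u v :: "nat list" assume "\<forall>i<2 * m. (u ! i, v ! i) \<in> leq_rel 2"
    then have "\<forall>i<2 * m. u ! i \<le> v ! i" by (auto simp: leq_rel_def)
    then have "\<forall>i<2 * m. H i t \<le> v ! i" if "\<forall>i<2 * m. H i t \<le> u ! i" for t
      using that order_trans by blast
    then have "F u = 1 \<longrightarrow> F v = 1" unfolding F_def by (metis zero_neq_one)
    moreover have "F u = 0 \<or> F u = 1" "F v = 0 \<or> F v = 1" by (simp_all add: F_def)
    ultimately show "(F u, F v) \<in> leq_rel 2" by (auto simp: leq_rel_def)
  qed (use m in \<open>auto simp: F_def\<close>)
  then have "operation_of 2 (2 * m) F \<in> K" using sub by blast
  from clone_composition[OF K this HK]
  have "operation_of 2 m (\<lambda>z. F (map (\<lambda>i. H i z) [0..<2 * m])) \<in> K" .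
  moreover have "F (map (\<lambda>i. H i z) [0..<2 * m]) = g z" if z: "z \<in> tuples 2 m" for z
  proof -
    have "t = z" if t: "t \<in> tuples 2 m" and le: "\<forall>i<2 * m. H i t \<le> H i z" for t
    proof (rule tuples_ext[OF t z])
      fix i assume i: "i < m"
      have "H i t \<le> H i z" "H (m + i) t \<le> H (m + i) z" using le i by auto
      then show "t ! i = z ! i"
        using i nth_tuples_less[OF t i] nth_tuples_less[OF z i]
        by (auto simp: H_def split: if_splits)
    qed
    then have "F (map (\<lambda>i. H i z) [0..<2 * m]) = (if g z = 1 then 1 else 0)"
      using z by (auto simp: F_def)
    then show ?thesis using g[OF z] by auto
  qed
  ultimately show "p \<in> K" unfolding p by (metis (no_types, lifting) operation_of_cong)
qed

lemma Pol_leq_proper: "Pol 2 {binary_rel (leq_rel 2)} \<noteq> operations 2"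
proof -
  let ?f = "\<lambda>z :: nat list. 1 - z ! 0"
  have "[0] \<in> tuples 2 1" "[1] \<in> tuples 2 1" by (auto simp: tuples_def)
  moreover have "\<forall>i<1. ([0] ! i, [1] ! i) \<in> leq_rel 2" "(?f [0], ?f [1]) \<notin> leq_rel 2"
    by (auto simp: leq_rel_def)
  ultimately have "operation_of 2 1 ?f \<notin> Pol 2 {binary_rel (leq_rel 2)}"
    unfolding operation_of_in_Pol_binary_iff[OF leq_rel_subset] by blast
  moreover have "operation_of 2 1 ?f \<in> operations 2"
    by (auto simp: operation_of_in_operations_iff)
  ultimately show ?thesis by blast
qed

section \<open>The unique maximal clone above a maximal C-clone\<close>

theorem theorem7p1:
  fixes n a b :: nat
  assumes "a \<in> {..<n} - {0}" and "b \<in> {..<n} - {n - 1}"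
  shows "(\<exists>!M. maximal_clone n M \<and> Pol n {clausal_rel n [a] [b]} \<subseteq> M) \<and>
    (n = 2 \<longrightarrow>
       Pol n {clausal_rel n [1] [0]} = Pol n {binary_rel (leq_rel n)} \<and>
       maximal_clone n (Pol n {binary_rel (leq_rel n)})) \<and>
    (n \<ge> 3 \<longrightarrow>
       (int a - int b > 1 \<longrightarrow>
          (let \<rho> = {0..b} \<union> {a..<n} in
             nontrivial_unary n \<rho> \<and>
             maximal_clone n (Pol n {unary_rel \<rho>}) \<and>
             Pol n {clausal_rel n [a] [b]} \<subseteq> Pol n {unary_rel \<rho>})) \<and>
       (int a - int b = 1 \<longrightarrow>
          (let \<theta> = {(x, y). \<exists>B\<in>{{0..b}, {a..<n}}. x \<in> B \<and> y \<in> B} in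
             equiv {..<n} \<theta> \<and> {..<n} // \<theta> = {{0..b}, {a..<n}} \<and>
             maximal_clone n (Pol n {binary_rel \<theta>}) \<and>
             Pol n {clausal_rel n [a] [b]} \<subseteq> Pol n {binary_rel \<theta>})) \<and>
       (int a - int b < 1 \<longrightarrow>
          (let \<sigma> = {0..b} \<times> {0..b} \<union> {a..<n} \<times> {a..<n} in
             binary_central n \<sigma> \<and>
             maximal_clone n (Pol n {binary_rel \<sigma>}) \<and>
             Pol n {clausal_rel n [a] [b]} \<subseteq> Pol n {binary_rel \<sigma>})))"
proof -
  have a: "0 < a" "a < n" and b: "b < n" "b < n - 1" using assms by auto
  let ?C = "Pol n {clausal_rel n [a] [b]}"
  let ?\<rho> = "{0..b} \<union> {a..<n}"
  let ?\<sigma> = "{0..b} \<times> {0..b} \<union> {a..<n} \<times> {a..<n}"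
  let ?\<theta> = "{(x, y). \<exists>B\<in>{{0..b}, {a..<n}}. x \<in> B \<and> y \<in> B}"
  have gap: "maximal_clone n (Pol n {unary_rel ?\<rho>})" "\<exists>!M. maximal_clone n M \<and> ?C \<subseteq> M"
    if "b + 1 < a"
    using unique_maximal_clone_above[OF Pol_clausal_subset_gap[OF a(2) b(1)]
        Pol_gap_proper[OF a(2) that] gap_generation[OF a(2) b(1) that]] by blast+
  have overlap: "maximal_clone n (Pol n {binary_rel ?\<sigma>})" "\<exists>!M. maximal_clone n M \<and> ?C \<subseteq> M"
    if "n \<ge> 3" "a \<le> b + 1"
    using unique_maximal_clone_above[OF Pol_clausal_subset_overlap[OF a(2) b(1) that(2)]
        Pol_overlap_proper[OF that(1) a b(2) that(2)]
        overlap_generation[OF a(2) b(1) that(2)]] by blast+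
  have two: "maximal_clone n (Pol n {binary_rel (leq_rel n)})"
      "\<exists>!M. maximal_clone n M \<and> ?C \<subseteq> M"
      "Pol n {clausal_rel n [1] [0]} = Pol n {binary_rel (leq_rel n)}" if "n = 2"
  proof -
    have "a = 1" "b = 0" using a b that by auto
    then have "?C = Pol 2 {binary_rel (leq_rel 2)}" using Pol_clausal_eq_Pol_leq that by simp
    then show "maximal_clone n (Pol n {binary_rel (leq_rel n)})"
      "\<exists>!M. maximal_clone n M \<and> ?C \<subseteq> M"
      "Pol n {clausal_rel n [1] [0]} = Pol n {binary_rel (leq_rel n)}"
      using unique_maximal_clone_above[OF subset_refl Pol_leq_proper boolean_generation]
        Pol_clausal_eq_Pol_leq that by simp_all
  qed
  have uniq: "\<exists>!M. maximal_clone n M \<and> ?C \<subseteq> M"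
  proof (cases "b + 1 < a")
    case True
    then show ?thesis by (rule gap(2))
  next
    case False
    then show ?thesis using overlap(2) two(2) b by (cases "n = 2") auto
  qed
  have first: "nontrivial_unary n ?\<rho>" if "b + 1 < a"
  proof -
    have "b + 1 \<in> {..<n} - ?\<rho>" using that a by auto
    moreover have "0 \<in> ?\<rho>" "?\<rho> \<subseteq> {..<n}" using b by auto
    ultimately show ?thesis unfolding nontrivial_unary_def by blast
  qed
  have \<theta>_eq: "?\<theta> = ?\<sigma>" by auto
  have second: "equiv {..<n} ?\<theta>" "{..<n} // ?\<theta> = {{0..b}, {a..<n}}" if ab: "a = b + 1"
  proof -
    show "equiv {..<n} ?\<theta>"
      unfolding \<theta>_eq using a ab by (auto simp: equiv_def refl_on_def sym_def trans_def)
    have cl: "?\<theta> `` {x} = (if x \<le> b then {0..b} else {a..<n})" if "x < n" for x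
      unfolding \<theta>_eq using that ab by auto
    show "{..<n} // ?\<theta> = {{0..b}, {a..<n}}"
    proof
      show "{..<n} // ?\<theta> \<subseteq> {{0..b}, {a..<n}}"
      proof
        fix X assume "X \<in> {..<n} // ?\<theta>"
        then obtain x where x: "x < n" "X = ?\<theta> `` {x}" by (auto elim: quotientE)
        then show "X \<in> {{0..b}, {a..<n}}" unfolding x(2) cl[OF x(1)] by simp
      qed
      have "?\<theta> `` {b} = {0..b}" "?\<theta> `` {a} = {a..<n}" using cl[of a] cl[of b] a b ab by auto
      then show "{{0..b}, {a..<n}} \<subseteq> {..<n} // ?\<theta>"
        using quotientI[of b "{..<n}" ?\<theta>] quotientI[of a "{..<n}" ?\<theta>] a b
        by (simp only: lessThan_iff insert_subset empty_subsetI simp_thms)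
    qed
  qed
  have third: "binary_central n ?\<sigma>" if ab: "a \<le> b"
  proof -
    have "(0, a) \<in> ?\<sigma> - Id_on {..<n}" "(0, n - 1) \<in> {..<n} \<times> {..<n} - ?\<sigma>"
      using a b ab by auto
    then have "?\<sigma> \<noteq> Id_on {..<n}" "?\<sigma> \<noteq> {..<n} \<times> {..<n}" by blast+
    moreover have "\<forall>x<n. (a, x) \<in> ?\<sigma> \<and> (x, a) \<in> ?\<sigma>" using a ab by auto
    moreover have "?\<sigma> \<subseteq> {..<n} \<times> {..<n}" "refl_on {..<n} ?\<sigma>" "sym ?\<sigma>"
      using a b ab by (auto simp: refl_on_def sym_def)
    ultimately show ?thesis unfolding binary_central_def using a by blast
  qed
  have "nontrivial_unary n ?\<rho> \<and> maximal_clone n (Pol n {unary_rel ?\<rho>}) \<and>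
      ?C \<subseteq> Pol n {unary_rel ?\<rho>}" if "int a - int b > 1"
    using that first gap(1) Pol_clausal_subset_gap[OF a(2) b(1)] by simp
  moreover have "equiv {..<n} ?\<theta> \<and> {..<n} // ?\<theta> = {{0..b}, {a..<n}} \<and>
      maximal_clone n (Pol n {binary_rel ?\<theta>}) \<and> ?C \<subseteq> Pol n {binary_rel ?\<theta>}"
    if "n \<ge> 3" "int a - int b = 1"
  proof -
    have "a = b + 1" using that by simp
    then show ?thesis
      using second overlap(1)[OF that(1)] Pol_clausal_subset_overlap[OF a(2) b(1)]
      unfolding \<theta>_eq by (intro conjI) (simp_all del: Un_iff)
  qed
  moreover have "binary_central n ?\<sigma> \<and> maximal_clone n (Pol n {binary_rel ?\<sigma>}) \<and>
      ?C \<subseteq> Pol n {binary_rel ?\<sigma>}" if "n \<ge> 3" "int a - int b < 1"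
    using that third overlap(1) Pol_clausal_subset_overlap[OF a(2) b(1)] by simp
  ultimately show ?thesis
    unfolding Let_def using uniq two(1,3) by iprover
qed

end
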